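(* Let $S$ be a numerical semigroup. Then $S$ is a MED-semigroup with maximal reduced type if and only if one of the following conditions holds: (1) $S$ is a half-line; (2) there exist integers $F,m$ such that $2\le m<F$, $m$ does not divide $F$, and $S=\Delta(F,m)$.
   Context: $\mathbb{N}=\{z\in\mathbb{Z}\mid z\ge 0\}$. A numerical semigroup is a submonoid $S$ of $(\mathbb{N},+)$ (containing $0$) with $\mathbb{N}\setminus S$ finite. The multiplicity $\mathrm{m}(S)$ is the smallest element of $S\setminus\{0\}$; the Frobenius number $\mathrm{F}(S)$ is the largest element of $\mathbb{Z}\setminus S$. Every numerical semigroup has a unique minimal system of generators $\mathrm{msg}(S)$; its cardinality $\mathrm{e}(S)$ is the embedding dimension. $S$ is a MED-semigroup (has maximal embedding dimension) if $\mathrm{e}(S)=\mathrm{m}(S)$. The set of pseudo-Frobenius numbers is $\mathrm{PF}(S)=\{x\in\mathbb{Z}\setminus S\mid x+s\in S\text{ for all }0\ne s\in S\}$, and the type $\mathrm{t}(S)$ is its cardinality. Put $\mathrm{rPF}(S)=\{x\in\mathbb{Z}\setminus S\mid \mathrm{F}(S)-\mathrm{m}(S)+1\le x\le \mathrm{F}(S)\}$ and let $s(S)$ be its cardinality (the reduced type); $S$ has maximal reduced type if $s(S)=\mathrm{t}(S)$. A half-line is a numerical semigroup of the form $\{x\in\mathbb{N}\mid x\ge m\}\cup\{0\}$ for some positive integer $m$. For integers $m,F$ with $2\le m<F$ and $m\nmid F$, $\Delta(F,m)=\langle m\rangle\cup\{x\in\mathbb{N}\mid x\ge F+1\}$, where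 $\langle m\rangle=\{\lambda m\mid\lambda\in\mathbb{N}\}$. *)

theory Defs
  imports Complex_Main
begin

text \<open>Everything lives in \<open>int\<close>, since Frobenius and pseudo-Frobenius numbers may be negative:
  for \<open>S = \<nat>\<close> the Frobenius number is \<open>-1\<close>. Here \<open>\<nat> :: int set\<close> is the set of nonnegative integers.\<close>

definition add_submonoid :: "int set \<Rightarrow> bool" where
  "add_submonoid M \<longleftrightarrow> 0 \<in> M \<and> (\<forall>x\<in>M. \<forall>y\<in>M. x + y \<in> M)"

definition numerical_semigroup :: "int set \<Rightarrow> bool" where
  "numerical_semigroup S \<longleftrightarrow> S \<subseteq> \<nat> \<and> add_submonoid S \<and> finite (\<nat> - S)"

definition multiplicity :: "int set \<Rightarrow> int" where
  "multiplicity S = (LEAST x. x \<in> S - {0})"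

definition frobenius :: "int set \<Rightarrow> int" where
  "frobenius S = (GREATEST x. x \<notin> S)"

definition minimal_generators :: "int set \<Rightarrow> int set \<Rightarrow> bool" where
  "minimal_generators S A \<longleftrightarrow>
     add_submonoid hull A = S \<and> (\<forall>B. B \<subset> A \<longrightarrow> add_submonoid hull B \<noteq> S)"

definition msg :: "int set \<Rightarrow> int set" where
  "msg S = (THE A. minimal_generators S A)"

definition embedding_dim :: "int set \<Rightarrow> nat" where
  "embedding_dim S = card (msg S)"

definition MED_semigroup :: "int set \<Rightarrow> bool" where
  "MED_semigroup S \<longleftrightarrow> numerical_semigroup S \<and> int (embedding_dim S) = multiplicity S"

definition PF :: "int set \<Rightarrow> int set" where
  "PF S = {x. x \<notin> S \<and> (\<forall>s\<in>S. s \<noteq> 0 \<longrightarrow> x + s \<in> S)}"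

definition semigroup_type :: "int set \<Rightarrow> nat" where
  "semigroup_type S = card (PF S)"

definition rPF :: "int set \<Rightarrow> int set" where
  "rPF S = {x. x \<notin> S \<and> frobenius S - multiplicity S + 1 \<le> x \<and> x \<le> frobenius S}"

definition reduced_type :: "int set \<Rightarrow> nat" where
  "reduced_type S = card (rPF S)"

definition maximal_reduced_type :: "int set \<Rightarrow> bool" where
  "maximal_reduced_type S \<longleftrightarrow> reduced_type S = semigroup_type S"

definition half_line :: "int set \<Rightarrow> bool" where
  "half_line S \<longleftrightarrow> numerical_semigroup S \<and> (\<exists>m>0. S = {x \<in> \<nat>. x \<ge> m} \<union> {0})"

text \<open>Only meant for \<open>2 \<le> m < F\<close> with \<open>\<not> m dvd F\<close>.\<close>

definition Delta :: "int \<Rightarrow> int \<Rightarrow> int set" where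
  "Delta F m = {l * m | l. l \<in> \<nat>} \<union> {x \<in> \<nat>. x \<ge> F + 1}"

text \<open>The description of \<open>msg\<close> is proper, and \<open>card (msg S)\<close> is a genuine cardinality.\<close>

lemma add_submonoid_hull: "add_submonoid (add_submonoid hull A)"
  by (rule hull_in) (auto simp: add_submonoid_def)

lemma minimal_generators_ex1_finite:
  assumes S: "numerical_semigroup S"
  shows "\<exists>!A. minimal_generators S A" and "finite (msg S)"
proof -
  define A where "A = {x \<in> S - {0}. \<not> (\<exists>y\<in>S - {0}. \<exists>z\<in>S - {0}. x = y + z)}"
  have nonneg: "x \<ge> 0" if "x \<in> S" for x
    using S that by (auto simp: numerical_semigroup_def Nats_altdef1)
  have sub: "add_submonoid S" using S by (simp add: numerical_semigroup_def)
  have hullA: "add_submonoid hull A = S"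
  proof
    show "add_submonoid hull A \<subseteq> S"
      by (rule hull_minimal) (auto simp: A_def sub)
    have "x \<in> S \<longrightarrow> x \<in> add_submonoid hull A" for x
    proof (induction "nat x" arbitrary: x rule: less_induct)
      case less
      show ?case
      proof
        assume x: "x \<in> S"
        consider "x = 0" | "x \<in> A" | y z where "y \<in> S - {0}" "z \<in> S - {0}" "x = y + z"
          using x by (auto simp: A_def)
        then show "x \<in> add_submonoid hull A"
        proof cases
          case 1
          then show ?thesis using add_submonoid_hull[of A] by (simp add: add_submonoid_def)
        next
          case 2
          then show ?thesis by (rule hull_inc)
        next
          case 3
          have "y > 0" "z > 0" using 3 nonneg by force+
          then have "y \<in> add_submonoid hull A" "z \<in> add_submonoid hull A"
            using less 3 by auto
          then show ?thesis using add_submonoid_hull[of A] 3 by (simp add: add_submonoid_def)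
        qed
      qed
    qed
    then show "S \<subseteq> add_submonoid hull A" by blast
  qed
  have A_sub: "A \<subseteq> B" if B: "add_submonoid hull B = S" for B
  proof
    fix x assume x: "x \<in> A"
    show "x \<in> B"
    proof (rule ccontr)
      assume "x \<notin> B"
      then have 1: "B \<subseteq> S - {x}" using hull_subset[of B add_submonoid] B by auto
      have 2: "add_submonoid (S - {x})"
        unfolding add_submonoid_def
      proof (intro conjI ballI)
        show "0 \<in> S - {x}" using x sub by (auto simp: A_def add_submonoid_def)
        fix y z assume "y \<in> S - {x}" "z \<in> S - {x}"
        then show "y + z \<in> S - {x}"
          using x sub unfolding A_def add_submonoid_def
          by (cases "y = 0"; cases "z = 0") auto
      qed
      show False using hull_minimal[of B "S - {x}" add_submonoid, OF 1 2] B x by (auto simp: A_def)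
    qed
  qed
  have min: "minimal_generators S A"
    unfolding minimal_generators_def using hullA A_sub by blast
  show ex1: "\<exists>!A. minimal_generators S A"
    using min A_sub hullA unfolding minimal_generators_def by (metis psubsetI)
  have "msg S = A"
    unfolding msg_def using min ex1 by (rule the1_equality[rotated])
  moreover have "finite A"
  proof -
    obtain b where b: "\<forall>x\<in>\<nat> - S. x < b"
      using S
      by (metis numerical_semigroup_def bdd_above_finite bdd_above_def zle_add1_eq_le)
    define n where "n = max 1 b"
    have n: "x \<in> S" if "x \<ge> n" for x
    proof (rule ccontr)
      assume "x \<notin> S"
      moreover have "x \<in> \<nat>" "\<not> x < b" using that by (auto simp: n_def Nats_altdef1)
      ultimately show False using b by blast
    qed
    have "x < 2 * n" if "x \<in> A" for x
    proof (rule ccontr)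
      assume "\<not> x < 2 * n"
      moreover have "n > 0" by (simp add: n_def)
      ultimately have "n \<in> S - {0}" "x - n \<in> S - {0}" using n by simp_all
      then show False using that by (force simp: A_def)
    qed
    then have "A \<subseteq> {0..<2*n}" using nonneg by (auto simp: A_def)
    then show ?thesis by (rule finite_subset) simp
  qed
  ultimately show "finite (msg S)" by simp
qed

end

theory Submission
  imports Defs
begin

text \<open>Write \<open>m\<close> for the multiplicity and \<open>F\<close> for the Frobenius number of \<open>S\<close>. The proof turns both
  sides of the equivalence into one condition: every element of \<open>S\<close> up to \<open>F\<close> is a multiple of \<open>m\<close>.

  Maximal embedding dimension is a closure property (\<open>MED_semigroup_iff_shift\<close>): the minimal
  generators are pairwise incongruent modulo \<open>m\<close>, so there are \<open>m\<close> of them exactly if every residue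
  class contains one, and this means that \<open>y + z - m \<in> S\<close> for all nonzero \<open>y, z \<in> S\<close>. Maximal
  reduced type says that no pseudo-Frobenius number lies below the window \<open>{F - m + 1..F}\<close>
  (\<open>maximal_reduced_type_iff\<close>).

  Now let both hold, and suppose that \<open>w \<in> S\<close> is at most \<open>F\<close> and not a multiple of \<open>m\<close>. Take \<open>w\<close>
  least among the elements of \<open>S\<close> in its residue class. Then \<open>w - m\<close> is a gap, by the closure property it is a
  pseudo-Frobenius number, and it lies below the window, which is impossible. Conversely, if
  the elements up to \<open>F\<close> are multiples of \<open>m\<close>, then \<open>y + z - m\<close> either exceeds \<open>F\<close> or is again a
  multiple of \<open>m\<close>, which gives the closure property. A pseudo-Frobenius number \<open>x \<le> F - m\<close> would be a
  negative multiple of \<open>m\<close> with \<open>x + m \<ge> 0\<close>, hence \<open>-m\<close>, and then \<open>F = -m + (F + m)\<close> would lie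
  in \<open>S\<close> (\<open>MED_maximal_reduced_type_iff\<close>). Finally, a semigroup whose
  elements up to \<open>F\<close> are multiples of \<open>m\<close> is a half-line if \<open>F < m\<close> and \<open>\<Delta>(F,m)\<close> otherwise.\<close>

section \<open>Multiplicity and Frobenius number\<close>

lemma least_nonneg_int:
  fixes a :: int
  assumes "P a" and "\<And>x. P x \<Longrightarrow> 0 \<le> x"
  obtains x where "P x" and "\<And>y. P y \<Longrightarrow> x \<le> y"
proof -
  obtain x where "P x" "\<forall>y. P y \<longrightarrow> nat x \<le> nat y"
    using ex_has_least_nat[of P a nat] assms(1) by blast
  then show thesis
    using that[of x] assms(2) by (metis nat_le_eq_zle order_antisym_conv nle_le)
qed

lemma numerical_semigroupD:
  assumes "numerical_semigroup S"
  shows numerical_semigroup_nonneg: "x \<in> S \<Longrightarrow> 0 \<le> x"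
    and numerical_semigroup_zero: "0 \<in> S"
    and numerical_semigroup_add: "x \<in> S \<Longrightarrow> y \<in> S \<Longrightarrow> x + y \<in> S"
  using assms by (auto simp: numerical_semigroup_def add_submonoid_def Nats_altdef1)

lemma
  assumes S: "numerical_semigroup S"
  shows frobenius_notin: "frobenius S \<notin> S"
    and gt_frobenius_in: "frobenius S < x \<Longrightarrow> x \<in> S"
proof -
  define G where "G = Max (insert (-1) (\<nat> - S))"
  have fin: "finite (insert (-1) (\<nat> - S))"
    using S by (simp add: numerical_semigroup_def)
  have "G \<in> insert (-1) (\<nat> - S)"
    unfolding G_def using fin by (rule Max_in) simp
  then have G: "G \<notin> S"
    using numerical_semigroup_nonneg[OF S, of "-1"] by auto
  have le: "x \<le> G" if "x \<notin> S" for x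
  proof (cases "0 \<le> x")
    case True
    then show ?thesis
      unfolding G_def using that fin by (intro Max_ge) (auto simp: Nats_altdef1)
  next
    case False
    moreover have "-1 \<le> G"
      unfolding G_def using fin by (intro Max_ge) auto
    ultimately show ?thesis by linarith
  qed
  have "frobenius S = G"
    unfolding frobenius_def using G le by (intro Greatest_equality)
  then show "frobenius S \<notin> S" and "frobenius S < x \<Longrightarrow> x \<in> S"
    using G le[of x] by auto
qed

lemma
  assumes S: "numerical_semigroup S"
  shows multiplicity_in: "multiplicity S \<in> S"
    and multiplicity_pos: "0 < multiplicity S"
    and multiplicity_le: "x \<in> S \<Longrightarrow> x \<noteq> 0 \<Longrightarrow> multiplicity S \<le> x"
proof -
  have "max 1 (frobenius S + 1) \<in> S - {0}"
    using gt_frobenius_in[OF S] by auto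
  then obtain k where k: "k \<in> S - {0}" "\<And>y. y \<in> S - {0} \<Longrightarrow> k \<le> y"
    using least_nonneg_int[of "\<lambda>x. x \<in> S - {0}"] numerical_semigroup_nonneg[OF S] by blast
  then have "multiplicity S = k"
    unfolding multiplicity_def by (intro Least_equality)
  then show "multiplicity S \<in> S" "0 < multiplicity S"
    "x \<in> S \<Longrightarrow> x \<noteq> 0 \<Longrightarrow> multiplicity S \<le> x"
    using k numerical_semigroup_nonneg[OF S, of k] by auto
qed

lemma add_multiple_multiplicity:
  assumes S: "numerical_semigroup S" and x: "x \<in> S" and k: "0 \<le> k"
  shows "x + k * multiplicity S \<in> S"
  using k
proof (induction k rule: int_ge_induct)
  case base
  then show ?case using x by simp
next
  case (step k)
  then have "(x + k * multiplicity S) + multiplicity S \<in> S"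
    using S multiplicity_in numerical_semigroup_add by blast
  then show ?case by (simp add: algebra_simps)
qed

lemma multiple_multiplicity_in:
  assumes S: "numerical_semigroup S" and x: "multiplicity S dvd x" "0 \<le> x"
  shows "x \<in> S"
proof -
  obtain k where k: "x = multiplicity S * k" using x(1) by blast
  then have "0 \<le> k"
    using x(2) multiplicity_pos[OF S] by (simp add: zero_le_mult_iff)
  then show ?thesis
    using add_multiple_multiplicity[OF S numerical_semigroup_zero[OF S]] k by (simp add: mult.commute)
qed

text \<open>Each residue class modulo \<open>m\<close> meets \<open>S\<close> in an upward closed set: within a class, the smaller
  element reaches the larger one in steps of \<open>m\<close>, and the last step still starts in \<open>S\<close>.\<close>

lemma cong_less_diff_multiplicity_in:
  assumes S: "numerical_semigroup S" and x: "x \<in> S"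
    and cong: "x mod multiplicity S = y mod multiplicity S" and less: "x < y"
  shows "y - multiplicity S \<in> S"
proof -
  obtain k where k: "y - x = multiplicity S * k"
    using cong by (metis mod_eq_dvd_iff dvd_def)
  then have "0 < multiplicity S * k" using less by linarith
  then have "0 \<le> k - 1"
    using multiplicity_pos[OF S] by (simp add: zero_less_mult_iff)
  from add_multiple_multiplicity[OF S x this] k show ?thesis
    by (simp add: algebra_simps)
qed

section \<open>Minimal generators\<close>

definition atoms :: "int set \<Rightarrow> int set" where
  "atoms S = {x \<in> S - {0}. \<forall>y\<in>S - {0}. \<forall>z\<in>S - {0}. x \<noteq> y + z}"

lemma hull_atoms:
  assumes S: "numerical_semigroup S"
  shows "add_submonoid hull atoms S = S"
proof
  show "add_submonoid hull atoms S \<subseteq> S"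
    using S by (intro hull_minimal) (auto simp: atoms_def numerical_semigroup_def)
next
  let ?H = "add_submonoid hull atoms S"
  have H: "0 \<in> ?H" "\<And>x y. x \<in> ?H \<Longrightarrow> y \<in> ?H \<Longrightarrow> x + y \<in> ?H"
    using add_submonoid_hull[of "atoms S"] unfolding add_submonoid_def[of ?H] by auto
  have "x \<in> add_submonoid hull atoms S" if "x \<in> S" for x
    using that
  proof (induction "nat x" arbitrary: x rule: less_induct)
    case less
    consider "x = 0" | "x \<in> atoms S" | y z where "y \<in> S - {0}" "z \<in> S - {0}" "x = y + z"
      using less.prems by (auto simp: atoms_def)
    then show ?case
    proof cases
      case 1
      then show ?thesis using H by simp
    next
      case 2
      then show ?thesis by (rule hull_inc)
    next
      case 3
      then have "0 < y" "0 < z"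
        using numerical_semigroup_nonneg[OF S] by force+
      then show ?thesis using less.hyps 3 H by auto
    qed
  qed
  then show "S \<subseteq> add_submonoid hull atoms S" by blast
qed

text \<open>Removing an atom \<open>x\<close> from \<open>S\<close> leaves a submonoid, so a set of generators that misses \<open>x\<close>
  generates nothing outside \<open>S - {x}\<close>.\<close>

lemma atoms_subset_generators:
  assumes S: "numerical_semigroup S" and B: "add_submonoid hull B = S"
  shows "atoms S \<subseteq> B"
proof (rule subsetI, rule ccontr)
  fix x assume x: "x \<in> atoms S" "x \<notin> B"
  have "add_submonoid (S - {x})"
    unfolding add_submonoid_def
  proof (intro conjI ballI)
    show "0 \<in> S - {x}"
      using x numerical_semigroup_zero[OF S] by (auto simp: atoms_def)
    show "y + z \<in> S - {x}" if "y \<in> S - {x}" "z \<in> S - {x}" for y z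
      using that x numerical_semigroup_add[OF S, of y z]
      by (cases "y = 0"; cases "z = 0") (auto simp: atoms_def)
  qed
  moreover have "B \<subseteq> S - {x}"
    using x hull_subset[of B add_submonoid] B by auto
  ultimately have "add_submonoid hull B \<subseteq> S - {x}"
    by (intro hull_minimal)
  then show False using B x by (auto simp: atoms_def)
qed

lemma msg_eq_atoms:
  assumes S: "numerical_semigroup S"
  shows "msg S = atoms S"
proof -
  have "minimal_generators S (atoms S)"
    using hull_atoms[OF S] atoms_subset_generators[OF S]
    unfolding minimal_generators_def by blast
  then show ?thesis
    unfolding msg_def using minimal_generators_ex1_finite(1)[OF S] by (intro the1_equality)
qed

lemma multiplicity_atom:
  assumes S: "numerical_semigroup S"
  shows "multiplicity S \<in> atoms S"
proof -
  have "multiplicity S \<noteq> y + z" if "y \<in> S - {0}" "z \<in> S - {0}" for y z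
    using that multiplicity_le[OF S, of y] multiplicity_le[OF S, of z] multiplicity_pos[OF S]
    by auto
  then show ?thesis
    using multiplicity_in[OF S] multiplicity_pos[OF S] by (auto simp: atoms_def)
qed

text \<open>An atom is the least nonzero element of its residue class modulo \<open>m\<close>, since a larger element
  splits off a summand \<open>m\<close>.\<close>

lemma atom_le_cong:
  assumes S: "numerical_semigroup S" and x: "x \<in> S" "x \<noteq> 0" and a: "a \<in> atoms S"
    and cong: "x mod multiplicity S = a mod multiplicity S"
  shows "a \<le> x"
proof (rule ccontr)
  assume less: "\<not> a \<le> x"
  then have "a - multiplicity S \<in> S"
    using cong_less_diff_multiplicity_in[OF S x(1) cong] by simp
  moreover have "a - multiplicity S \<noteq> 0"
    using less multiplicity_le[OF S x] by linarith
  ultimately show False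
    using a multiplicity_in[OF S] multiplicity_pos[OF S] by (force simp: atoms_def)
qed

lemma inj_on_atoms_mod_multiplicity:
  assumes S: "numerical_semigroup S"
  shows "inj_on (\<lambda>a. a mod multiplicity S) (atoms S)"
proof (rule inj_onI)
  fix a b assume ab: "a \<in> atoms S" "b \<in> atoms S" "a mod multiplicity S = b mod multiplicity S"
  then have "a \<in> S" "a \<noteq> 0" "b \<in> S" "b \<noteq> 0" by (auto simp: atoms_def)
  then show "a = b"
    using ab atom_le_cong[OF S, of a b] atom_le_cong[OF S, of b a] by force
qed

section \<open>Maximal embedding dimension\<close>

lemma MED_semigroup_iff_residues:
  assumes S: "numerical_semigroup S"
  shows "MED_semigroup S \<longleftrightarrow> (\<lambda>a. a mod multiplicity S) ` atoms S = {0..<multiplicity S}"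
    (is "_ \<longleftrightarrow> ?R = _")
proof -
  have sub: "?R \<subseteq> {0..<multiplicity S}"
    using multiplicity_pos[OF S] by auto
  have "card (atoms S) = card ?R"
    using card_image[OF inj_on_atoms_mod_multiplicity[OF S]] by simp
  then have "MED_semigroup S \<longleftrightarrow> card ?R = card {0..<multiplicity S}"
    using S multiplicity_pos[OF S] unfolding MED_semigroup_def embedding_dim_def
    by (simp add: msg_eq_atoms int_eq_iff)
  also have "\<dots> \<longleftrightarrow> ?R = {0..<multiplicity S}"
    using card_subset_eq[OF _ sub] by (metis finite_atLeastLessThan_int)
  finally show ?thesis .
qed

text \<open>If every residue class contains an atom, then a sum \<open>y + z\<close> of nonzero elements is larger than
  the atom of its class, being no atom itself, and so stays in \<open>S\<close> when \<open>m\<close> is subtracted.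
  Conversely, the closure property makes the least nonzero element of each class an atom: if it
  were a sum, subtracting \<open>m\<close> would give a smaller one.\<close>

lemma MED_semigroup_iff_shift:
  assumes S: "numerical_semigroup S"
  shows "MED_semigroup S \<longleftrightarrow> (\<forall>y\<in>S - {0}. \<forall>z\<in>S - {0}. y + z - multiplicity S \<in> S)"
    (is "_ \<longleftrightarrow> ?shift")
proof -
  define m where "m = multiplicity S"
  have m: "0 < m" "m \<in> S" using multiplicity_pos[OF S] multiplicity_in[OF S] by (auto simp: m_def)
  have "(\<lambda>a. a mod m) ` atoms S = {0..<m} \<longleftrightarrow> ?shift"
  proof
    assume surj: "(\<lambda>a. a mod m) ` atoms S = {0..<m}"
    show ?shift
    proof (intro ballI)
      fix y z assume yz: "y \<in> S - {0}" "z \<in> S - {0}"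
      have "(y + z) mod m \<in> {0..<m}" using m by simp
      then obtain b where b: "b \<in> atoms S" "b mod m = (y + z) mod m"
        unfolding surj[symmetric] by force
      have sum: "y + z \<in> S" "y + z \<noteq> 0"
        using yz numerical_semigroup_add[OF S] numerical_semigroup_nonneg[OF S]
        by (auto simp: add_nonneg_eq_0_iff)
      then have "b \<le> y + z"
        using b by (intro atom_le_cong[OF S]) (auto simp: m_def)
      moreover have "b \<noteq> y + z" using b(1) yz by (auto simp: atoms_def)
      ultimately show "y + z - multiplicity S \<in> S"
        using b by (intro cong_less_diff_multiplicity_in[OF S, of b]) (auto simp: m_def atoms_def)
    qed
  next
    assume shift: ?shift
    have "r \<in> (\<lambda>a. a mod m) ` atoms S" if r: "r \<in> {0..<m}" for r
    proof -
      define P where "P x \<longleftrightarrow> x \<in> S - {0} \<and> x mod m = r" for x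
      \<comment> \<open>The class of \<open>r\<close> contains an integer above both \<open>F\<close> and \<open>0\<close>, which is then in \<open>S\<close>.\<close>
      define N where "N = \<bar>frobenius S\<bar> + 1"
      have "N * 1 \<le> N * m" using m by (intro mult_left_mono) (auto simp: N_def)
      moreover have "frobenius S < N" "0 < N" by (auto simp: N_def)
      moreover have "0 \<le> r" using r by simp
      ultimately have "frobenius S < r + N * m" "0 < r + N * m" by linarith+
      then have "P (r + N * m)"
        using r gt_frobenius_in[OF S] by (auto simp: P_def)
      then obtain x where x: "P x" "\<And>y. P y \<Longrightarrow> x \<le> y"
        using least_nonneg_int[of P] numerical_semigroup_nonneg[OF S] unfolding P_def by blast
      have "x \<in> atoms S"
      proof (rule ccontr)
        assume na: "x \<notin> atoms S"
        then obtain y z where "y \<in> S - {0}" "z \<in> S - {0}" "x = y + z"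
          using x(1) by (auto simp: P_def atoms_def)
        then have "x - m \<in> S" using shift by (auto simp: m_def)
        moreover have "x \<noteq> m" using na multiplicity_atom[OF S] by (auto simp: m_def)
        ultimately have "P (x - m)" using x(1) by (auto simp: P_def)
        then show False using x(2)[of "x - m"] m by simp
      qed
      then show ?thesis using x(1) by (auto simp: P_def)
    qed
    then show "(\<lambda>a. a mod m) ` atoms S = {0..<m}" using m by auto
  qed
  then show ?thesis using MED_semigroup_iff_residues[OF S] by (simp add: m_def)
qed

section \<open>Maximal reduced type\<close>

text \<open>A gap in the top window is a pseudo-Frobenius number, since adding a nonzero element of \<open>S\<close>
  adds at least \<open>m\<close> and so exceeds \<open>F\<close>. As there are only finitely many pseudo-Frobenius numbers,
  equal cardinalities mean equal sets.\<close>

lemma maximal_reduced_type_iff: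
  assumes S: "numerical_semigroup S"
  shows "maximal_reduced_type S \<longleftrightarrow> (\<forall>x\<in>PF S. frobenius S - multiplicity S < x)"
proof -
  have sub: "rPF S \<subseteq> PF S"
  proof
    fix x assume x: "x \<in> rPF S"
    have "x + s \<in> S" if "s \<in> S" "s \<noteq> 0" for s
      using x multiplicity_le[OF S that] by (intro gt_frobenius_in[OF S]) (auto simp: rPF_def)
    then show "x \<in> PF S" using x by (auto simp: PF_def rPF_def)
  qed
  have le: "x \<le> frobenius S" if "x \<in> PF S" for x
    using that gt_frobenius_in[OF S, of x] by (force simp: PF_def)
  have "- multiplicity S \<le> x" if "x \<in> PF S" for x
  proof -
    have "x + multiplicity S \<in> S"
      using that multiplicity_in[OF S] multiplicity_pos[OF S] by (auto simp: PF_def)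
    then show ?thesis using numerical_semigroup_nonneg[OF S] by force
  qed
  then have "PF S \<subseteq> {- multiplicity S..frobenius S}" using le by auto
  then have "finite (PF S)" by (rule finite_subset) simp
  then have "maximal_reduced_type S \<longleftrightarrow> rPF S = PF S"
    using sub card_subset_eq[of "PF S" "rPF S"]
    by (auto simp: maximal_reduced_type_def reduced_type_def semigroup_type_def)
  also have "\<dots> \<longleftrightarrow> (\<forall>x\<in>PF S. frobenius S - multiplicity S < x)"
  proof
    assume eq: "rPF S = PF S"
    show "\<forall>x\<in>PF S. frobenius S - multiplicity S < x"
      unfolding eq[symmetric] by (auto simp: rPF_def)
  next
    assume top: "\<forall>x\<in>PF S. frobenius S - multiplicity S < x"
    have "x \<in> rPF S" if "x \<in> PF S" for x
      using top[rule_format, OF that] le[OF that] that by (auto simp: rPF_def PF_def)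
    then show "rPF S = PF S" using sub by blast
  qed
  finally show ?thesis .
qed

section \<open>The classification\<close>

lemma MED_maximal_reduced_type_iff:
  assumes S: "numerical_semigroup S"
  shows "MED_semigroup S \<and> maximal_reduced_type S \<longleftrightarrow>
    (\<forall>y\<in>S. y \<le> frobenius S \<longrightarrow> multiplicity S dvd y)"
proof -
  define m F where "m = multiplicity S" and "F = frobenius S"
  have m: "0 < m" "m \<in> S" using multiplicity_pos[OF S] multiplicity_in[OF S] by (auto simp: m_def)
  let ?shift = "\<forall>y\<in>S - {0}. \<forall>z\<in>S - {0}. y + z - m \<in> S"
  let ?top = "\<forall>x\<in>PF S. F - m < x"
  have "?shift \<and> ?top \<longleftrightarrow> (\<forall>y\<in>S. y \<le> F \<longrightarrow> m dvd y)"
  proof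
    assume A: "?shift \<and> ?top"
    show "\<forall>y\<in>S. y \<le> F \<longrightarrow> m dvd y"
    proof (intro ballI impI, rule ccontr)
      fix y assume y: "y \<in> S" "y \<le> F" "\<not> m dvd y"
      define P where "P x \<longleftrightarrow> x \<in> S \<and> x mod m = y mod m" for x
      obtain w where w: "P w" "\<And>x. P x \<Longrightarrow> w \<le> x"
        using least_nonneg_int[of P y] y numerical_semigroup_nonneg[OF S] unfolding P_def by blast
      have w0: "w \<noteq> 0" using w(1) y(3) by (auto simp: P_def)
      have "w \<le> F" using w(2)[of y] y by (auto simp: P_def)
      have "w - m \<notin> S" using w(1) w(2)[of "w - m"] m by (auto simp: P_def)
      moreover have "w - m + s \<in> S" if "s \<in> S" "s \<noteq> 0" for s
        using A that w(1) w0 by (auto simp: P_def algebra_simps)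
      ultimately have "w - m \<in> PF S" by (auto simp: PF_def)
      then show False using A \<open>w \<le> F\<close> by force
    qed
  next
    assume A: "\<forall>y\<in>S. y \<le> F \<longrightarrow> m dvd y"
    have shift: "y + z - m \<in> S" if "y \<in> S - {0}" "z \<in> S - {0}" for y z
    proof (cases "F < y + z - m")
      case True
      then show ?thesis using gt_frobenius_in[OF S] by (simp add: F_def)
    next
      case False
      have le: "m \<le> y" "m \<le> z"
        using that multiplicity_le[OF S] by (auto simp: m_def)
      then have "m dvd y" "m dvd z" using A that False by auto
      then have "m dvd y + z - m" by simp
      then show ?thesis
        using le m by (intro multiple_multiplicity_in[OF S]) (auto simp: m_def)
    qed
    have top: "F - m < x" if x: "x \<in> PF S" for x
    proof (rule ccontr)
      assume "\<not> F - m < x"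
      then have le: "x \<le> F - m" by simp
      have xm: "x + m \<in> S" using x m by (auto simp: PF_def)
      then have "m dvd x" using A le by fastforce
      moreover have "x \<notin> S" using x by (simp add: PF_def)
      ultimately have "x < 0"
        using multiple_multiplicity_in[OF S, of x] by (force simp: m_def)
      then have "m \<le> - x" using zdvd_imp_le[of m "- x"] \<open>m dvd x\<close> by simp
      moreover have "0 \<le> x + m" using xm numerical_semigroup_nonneg[OF S] by blast
      ultimately have "x = - m" by simp
      \<comment> \<open>But \<open>-m\<close> is no pseudo-Frobenius number: adding \<open>F + m \<in> S\<close> to it gives the gap \<open>F\<close>.\<close>
      moreover have "F + m \<in> S" using m gt_frobenius_in[OF S] by (simp add: F_def)
      moreover have "F + m \<noteq> 0" using le m \<open>x = - m\<close> by simp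
      ultimately have "F \<in> S" using x by (force simp: PF_def)
      then show False using frobenius_notin[OF S] by (simp add: F_def)
    qed
    show "?shift \<and> ?top" using shift top by blast
  qed
  then show ?thesis
    using MED_semigroup_iff_shift[OF S] maximal_reduced_type_iff[OF S] by (simp add: m_def F_def)
qed

theorem corollary5:
  fixes S :: "int set"
  assumes "numerical_semigroup S"
  shows "(MED_semigroup S \<and> maximal_reduced_type S) \<longleftrightarrow>
         (half_line S \<or>
          (\<exists>F m. 2 \<le> m \<and> m < F \<and> \<not> m dvd F \<and> S = Delta F m))"
proof -
  note S = assms
  define m F where "m = multiplicity S" and "F = frobenius S"
  have m: "0 < m" "m \<in> S" "\<And>x. x \<in> S \<Longrightarrow> x \<noteq> 0 \<Longrightarrow> m \<le> x"
    using multiplicity_pos[OF S] multiplicity_in[OF S] multiplicity_le[OF S]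
    by (auto simp: m_def)
  have F: "F \<notin> S" "\<And>x. F < x \<Longrightarrow> x \<in> S"
    using frobenius_notin[OF S] gt_frobenius_in[OF S] by (auto simp: F_def)
  note nonneg = numerical_semigroup_nonneg[OF S]
  have "(\<forall>y\<in>S. y \<le> F \<longrightarrow> m dvd y) \<longleftrightarrow>
    half_line S \<or> (\<exists>F m. 2 \<le> m \<and> m < F \<and> \<not> m dvd F \<and> S = Delta F m)"
  proof
    assume A: "\<forall>y\<in>S. y \<le> F \<longrightarrow> m dvd y"
    show "half_line S \<or> (\<exists>F m. 2 \<le> m \<and> m < F \<and> \<not> m dvd F \<and> S = Delta F m)"
    proof (cases "F < m")
      case True
      then have "S = {x \<in> \<nat>. m \<le> x} \<union> {0}"
        using m F nonneg numerical_semigroup_zero[OF S] by (force simp: Nats_altdef1)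
      then show ?thesis using S m(1) by (auto simp: half_line_def)
    next
      case False
      then have "m < F" using m(2) F(1) by (cases "m = F") auto
      have ndvd: "\<not> m dvd F"
        using multiple_multiplicity_in[OF S, of F] F(1) m(1) \<open>m < F\<close> by (auto simp: m_def)
      have "m \<noteq> 1" using ndvd by auto
      have "S = Delta F m"
      proof (intro subset_antisym subsetI)
        fix x assume x: "x \<in> S"
        show "x \<in> Delta F m"
        proof (cases "F < x")
          case True
          then show ?thesis using nonneg[OF x] by (auto simp: Delta_def Nats_altdef1)
        next
          case False
          then obtain k where k: "x = m * k" using A x by (meson dvdE not_less)
          then have "0 \<le> k" using nonneg[OF x] m(1) by (simp add: zero_le_mult_iff)
          then show ?thesis using k by (auto simp: Delta_def Nats_altdef1 mult.commute)
        qed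
      next
        fix x assume "x \<in> Delta F m"
        then show "x \<in> S"
          using F(2) m(1) multiple_multiplicity_in[OF S]
          by (auto simp: Delta_def Nats_altdef1 m_def)
      qed
      then show ?thesis using \<open>m < F\<close> ndvd \<open>m \<noteq> 1\<close> m(1)
        by (intro disjI2 exI[of _ F] exI[of _ m]) simp
    qed
  next
    assume "half_line S \<or> (\<exists>F m. 2 \<le> m \<and> m < F \<and> \<not> m dvd F \<and> S = Delta F m)"
    then show "\<forall>y\<in>S. y \<le> F \<longrightarrow> m dvd y"
    proof
      assume "half_line S"
      then obtain k where k: "0 < k" "S = {x \<in> \<nat>. k \<le> x} \<union> {0}"
        unfolding half_line_def by blast
      have "F < k"
      proof (rule ccontr)
        assume "\<not> F < k"
        then have "F \<in> {x \<in> \<nat>. k \<le> x} \<union> {0}" using k(1) by (simp add: Nats_altdef1)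
        then show False using F(1) k(2) by blast
      qed
      have "y = 0" if "y \<in> S" "y \<le> F" for y
        using that \<open>F < k\<close> unfolding k(2) by auto
      then show ?thesis by auto
    next
      assume "\<exists>F m. 2 \<le> m \<and> m < F \<and> \<not> m dvd F \<and> S = Delta F m"
      then obtain G k where k: "2 \<le> k" "k < G" "S = Delta G k" by blast
      have mult: "k dvd x" if "x \<in> S" "x \<le> G" for x
        using that unfolding k(3) Delta_def by auto
      have "1 * k \<in> S" unfolding k(3) Delta_def using Nats_1 by blast
      then have "m \<le> k" using m(3)[of k] k(1) by simp
      moreover have "k \<le> m"
        using mult[OF m(2)] \<open>m \<le> k\<close> k(2) m(1) by (simp add: zdvd_imp_le)
      ultimately have "m = k" by simp
      have "F \<le> G"
      proof (rule ccontr)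
        assume "\<not> F \<le> G"
        then have "F \<in> Delta G k" using k(1,2) by (simp add: Delta_def Nats_altdef1)
        then show False using F(1) k(3) by blast
      qed
      then show ?thesis unfolding \<open>m = k\<close> using mult order_trans by blast
    qed
  qed
  then show ?thesis using MED_maximal_reduced_type_iff[OF S] by (simp add: m_def F_def)
qed

end
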